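(* Let $G$ be a finitely generated group that fits in an exact sequence \[ 1\to L\to G\to\mathbb{Z}\to1, \] where $L$ is locally normally finite. Then $G$ has Shalom's property $H_{\mathrm{T}}$, and hence property $H_{\mathrm{FD}}$.
   Context: A group $L$ is locally normally finite if every finite subset of $L$ is contained in a finite normal subgroup of $L$. For a unitary representation $\pi:G\to\mathcal{U}(\mathcal{H})$, a $1$-cocycle is a map $b:G\to\mathcal{H}$ with $b(gh)=b(g)+\pi_g b(h)$; a $1$-coboundary is one of the form $b(g)=v-\pi_g v$. The first reduced cohomology $\overline{H}^1(G,\pi)$ is the space of $1$-cocycles modulo the closure (for uniform convergence on finite subsets) of the $1$-coboundaries. A finitely generated group $G$ has property $H_{\mathrm{FD}}$ (resp. $H_{\mathrm{T}}$) if every unitary representation $\pi$ of $G$ with $\overline{H}^1(G,\pi)\neq 0$ admits a nonzero finite-dimensional subrepresentation (resp. a nonzero $G$-invariant vector). *)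

theory Defs
  imports Complex_Main "HOL-Algebra.Elementary_Groups" "HOL-Algebra.Generated_Groups"
    "HOL-Algebra.Coset"
begin

class complex_vector = real_vector +
  fixes scaleC :: "complex \<Rightarrow> 'a \<Rightarrow> 'a"
  assumes scaleC_add_right: "scaleC a (x + y) = scaleC a x + scaleC a y"
    and scaleC_add_left: "scaleC (a + b) x = scaleC a x + scaleC b x"
    and scaleC_scaleC: "scaleC a (scaleC b x) = scaleC (a * b) x"
    and scaleC_one: "scaleC 1 x = x"
    and scaleR_scaleC: "scaleR r x = scaleC (complex_of_real r) x"

class complex_inner = complex_vector + real_normed_vector +
  fixes cinner :: "'a \<Rightarrow> 'a \<Rightarrow> complex"
  assumes cinner_commute: "cinner x y = cnj (cinner y x)"
    and cinner_add_left: "cinner (x + y) z = cinner x z + cinner y z"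
    and cinner_scaleC_left: "cinner (scaleC r x) y = cnj r * cinner x y"
    and cinner_ge_zero: "0 \<le> Re (cinner x x)"
    and cinner_eq_zero_iff: "cinner x x = 0 \<longleftrightarrow> x = 0"
    and norm_eq_sqrt_cinner: "norm x = sqrt (Re (cinner x x))"

class chilbert_space = complex_inner + complete_space


instantiation complex :: chilbert_space
begin
definition scaleC_complex :: "complex \<Rightarrow> complex \<Rightarrow> complex" where "scaleC_complex a x = a * x"
definition cinner_complex :: "complex \<Rightarrow> complex \<Rightarrow> complex" where "cinner_complex x y = cnj x * y"
instance
proof
  fix x :: complex
  show "norm x = sqrt (Re (cinner x x))"
    by (simp add: cinner_complex_def complex_norm_square[symmetric] cmod_def power2_eq_square)
next
  fix x :: complex
  have "cinner x x = complex_of_real ((cmod x)\<^sup>2)"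
    by (simp add: cinner_complex_def complex_norm_square[symmetric] mult.commute)
  then show "cinner x x = 0 \<longleftrightarrow> x = 0" by simp
qed (auto simp: scaleC_complex_def cinner_complex_def algebra_simps scaleR_conv_of_real
         complex_mult_cnj complex_cnj_zero_iff)
end

definition finitely_generated_group :: "('g, 'b) monoid_scheme \<Rightarrow> bool" where
  "finitely_generated_group G \<longleftrightarrow> group G \<and>
     (\<exists>S. finite S \<and> S \<subseteq> carrier G \<and> generate G S = carrier G)"

definition locally_normally_finite :: "('g, 'b) monoid_scheme \<Rightarrow> bool" where
  "locally_normally_finite L \<longleftrightarrow> group L \<and>
     (\<forall>F. finite F \<and> F \<subseteq> carrier L \<longrightarrow> (\<exists>N. F \<subseteq> N \<and> finite N \<and> N \<lhd> L))"

definition extension_of_Z_by_LNF :: "('g, 'b) monoid_scheme \<Rightarrow> bool" where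
  "extension_of_Z_by_LNF G \<longleftrightarrow> group G \<and>
     (\<exists>\<phi>. \<phi> \<in> hom G integer_group \<and> \<phi> ` carrier G = carrier integer_group \<and>
          locally_normally_finite (G\<lparr>carrier := kernel G integer_group \<phi>\<rparr>))"

definition unitary_operator :: "('h::chilbert_space \<Rightarrow> 'h) \<Rightarrow> bool" where
  "unitary_operator U \<longleftrightarrow> surj U \<and>
     (\<forall>x y. U (x + y) = U x + U y) \<and> (\<forall>c x. U (scaleC c x) = scaleC c (U x)) \<and>
     (\<forall>x y. cinner (U x) (U y) = cinner x y)"

definition unitary_rep :: "('g, 'b) monoid_scheme \<Rightarrow> ('g \<Rightarrow> 'h::chilbert_space \<Rightarrow> 'h) \<Rightarrow> bool" where
  "unitary_rep G \<pi> \<longleftrightarrow>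
     (\<forall>g\<in>carrier G. unitary_operator (\<pi> g)) \<and>
     (\<forall>g\<in>carrier G. \<forall>h\<in>carrier G. \<pi> (g \<otimes>\<^bsub>G\<^esub> h) = \<pi> g \<circ> \<pi> h) \<and>
     \<pi> \<one>\<^bsub>G\<^esub> = id"

definition cocycle :: "('g, 'b) monoid_scheme \<Rightarrow> ('g \<Rightarrow> 'h::chilbert_space \<Rightarrow> 'h) \<Rightarrow> ('g \<Rightarrow> 'h) \<Rightarrow> bool" where
  "cocycle G \<pi> b \<longleftrightarrow>
     (\<forall>g\<in>carrier G. \<forall>h\<in>carrier G. b (g \<otimes>\<^bsub>G\<^esub> h) = b g + \<pi> g (b h))"

definition in_closure_coboundaries ::
  "('g, 'b) monoid_scheme \<Rightarrow> ('g \<Rightarrow> 'h::chilbert_space \<Rightarrow> 'h) \<Rightarrow> ('g \<Rightarrow> 'h) \<Rightarrow> bool" where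
  "in_closure_coboundaries G \<pi> b \<longleftrightarrow>
     (\<forall>F e. finite F \<and> F \<subseteq> carrier G \<and> e > 0 \<longrightarrow>
        (\<exists>v. \<forall>g\<in>F. norm (b g - (v - \<pi> g v)) < e))"

definition reduced_H1_nonzero :: "('g, 'b) monoid_scheme \<Rightarrow> ('g \<Rightarrow> 'h::chilbert_space \<Rightarrow> 'h) \<Rightarrow> bool" where
  "reduced_H1_nonzero G \<pi> \<longleftrightarrow> (\<exists>b. cocycle G \<pi> b \<and> \<not> in_closure_coboundaries G \<pi> b)"

definition complex_span :: "'h::complex_vector set \<Rightarrow> 'h set" where
  "complex_span B = {\<Sum>x\<in>B. scaleC (c x) x | c. True}"

text \<open>A nonzero finite-dimensional (hence closed) invariant subspace.\<close>
definition has_nonzero_fd_subrep :: "('g, 'b) monoid_scheme \<Rightarrow> ('g \<Rightarrow> 'h::chilbert_space \<Rightarrow> 'h) \<Rightarrow> bool" where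
  "has_nonzero_fd_subrep G \<pi> \<longleftrightarrow>
     (\<exists>B. finite B \<and> (\<exists>v\<in>complex_span B. v \<noteq> 0) \<and>
        (\<forall>g\<in>carrier G. \<forall>v\<in>complex_span B. \<pi> g v \<in> complex_span B))"

definition has_nonzero_invariant_vector :: "('g, 'b) monoid_scheme \<Rightarrow> ('g \<Rightarrow> 'h::chilbert_space \<Rightarrow> 'h) \<Rightarrow> bool" where
  "has_nonzero_invariant_vector G \<pi> \<longleftrightarrow> (\<exists>v. v \<noteq> 0 \<and> (\<forall>g\<in>carrier G. \<pi> g v = v))"

text \<open>Properties H_T and H_FD, tested on unitary representations on Hilbert spaces of
  the type 'h (the main theorem is stated for an arbitrary such type).\<close>
definition property_HT :: "('g, 'b) monoid_scheme \<Rightarrow> 'h::chilbert_space itself \<Rightarrow> bool" where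
  "property_HT G _ \<longleftrightarrow> finitely_generated_group G \<and>
     (\<forall>\<pi> :: 'g \<Rightarrow> 'h \<Rightarrow> 'h. unitary_rep G \<pi> \<and> reduced_H1_nonzero G \<pi> \<longrightarrow>
        has_nonzero_invariant_vector G \<pi>)"

definition property_HFD :: "('g, 'b) monoid_scheme \<Rightarrow> 'h::chilbert_space itself \<Rightarrow> bool" where
  "property_HFD G _ \<longleftrightarrow> finitely_generated_group G \<and>
     (\<forall>\<pi> :: 'g \<Rightarrow> 'h \<Rightarrow> 'h. unitary_rep G \<pi> \<and> reduced_H1_nonzero G \<pi> \<longrightarrow>
        has_nonzero_fd_subrep G \<pi>)"

end

theory Submission
  imports Defs "HOL-Analysis.Analysis"
begin

text \<open>Suppose that \<open>\<pi>\<close> has no nonzero invariant vector, let \<open>t\<close> lift the generator of the quotient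
  \<open>\<int>\<close> and let \<open>A\<close> be a finite normal subgroup of \<open>L\<close> that generates \<open>G\<close> together with \<open>t\<close>. The
  conjugates \<open>A\<^sub>j\<close> of \<open>A\<close> by \<open>t ^ j\<close> are normal in \<open>L\<close>, hence the affine projections
  onto their fixed points (for the affine action \<open>x \<mapsto> \<pi> g x + b g\<close>) commute, and
  orthogonality shows that a common fixed point of \<open>n\<close> consecutive \<open>A\<^sub>j\<close> can be found at
  distance \<open>O(n)\<close> from the origin. Averaging it over the powers of \<open>t\<close> gives fixed points of \<open>A\<close>
  whose displacements under \<open>t\<close> are bounded and invariant under more and more \<open>A\<^sub>j\<close>. As weak limits of
  such displacements are invariant under \<open>G\<close> and thus zero, convex combinations of them are small.\<close>

section \<open>The real inner product\<close>

text \<open>The geometric arguments need only real linearity, and the real part induces the same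
  norm; this makes \<open>linear\<close> and \<open>bounded_bilinear\<close> available.\<close>

definition rinner :: "'h::complex_inner \<Rightarrow> 'h \<Rightarrow> real" where
  "rinner x y = Re (cinner x y)"

lemma rinner_commute: "rinner x y = rinner y x"
  unfolding rinner_def by (subst cinner_commute) simp

lemma rinner_add_left: "rinner (x + y) z = rinner x z + rinner y z"
  by (simp add: rinner_def cinner_add_left)

lemma rinner_scaleR_left: "rinner (r *\<^sub>R x) y = r * rinner x y"
  by (simp add: rinner_def scaleR_scaleC cinner_scaleC_left)

lemma rinner_self: "rinner x x = (norm x)\<^sup>2"
  by (simp add: rinner_def norm_eq_sqrt_cinner cinner_ge_zero)

lemma norm_add_square: "(norm (x + y))\<^sup>2 = (norm x)\<^sup>2 + 2 * rinner x y + (norm y)\<^sup>2"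
proof -
  have "rinner (x + y) (x + y) = rinner x (x + y) + rinner y (x + y)"
    by (rule rinner_add_left)
  also have "\<dots> = rinner (x + y) x + rinner (x + y) y"
    by (simp add: rinner_commute)
  finally show ?thesis
    using rinner_commute[of x y] by (simp add: rinner_add_left rinner_self)
qed

lemma rinner_le_norm: "rinner x y \<le> norm x * norm y"
proof (cases "x = 0 \<or> y = 0")
  case True
  then show ?thesis
    using rinner_scaleR_left[of 0 0 y] rinner_scaleR_left[of 0 0 x] rinner_commute[of x y] by auto
next
  case False
  have "0 \<le> (norm (norm y *\<^sub>R x + (- norm x) *\<^sub>R y))\<^sup>2" by simp
  also have "\<dots> = 2 * (norm x * norm y)\<^sup>2 - 2 * (norm x * norm y) * rinner x y"
    unfolding norm_add_square
      rinner_scaleR_left rinner_commute[of x "(- norm x) *\<^sub>R y"] rinner_commute[of y x]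
    by (simp add: power_mult_distrib power2_eq_square)
  finally have "(norm x * norm y) * rinner x y \<le> (norm x * norm y) * (norm x * norm y)"
    by (simp add: power2_eq_square)
  then show ?thesis using False by (simp add: mult_le_cancel_left)
qed

interpretation rinner: bounded_bilinear "rinner :: 'h::complex_inner \<Rightarrow> 'h \<Rightarrow> real"
proof
  fix x y z :: 'h and r :: real
  show "rinner (x + y) z = rinner x z + rinner y z" by (rule rinner_add_left)
  show "rinner x (y + z) = rinner x y + rinner x z"
    using rinner_add_left[of y z x] by (simp add: rinner_commute)
  show "rinner (r *\<^sub>R x) y = r *\<^sub>R rinner x y" by (simp add: rinner_scaleR_left)
  show "rinner x (r *\<^sub>R y) = r *\<^sub>R rinner x y"
    using rinner_scaleR_left[of r y x] by (simp add: rinner_commute)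
  have "\<bar>rinner x y\<bar> \<le> norm x * norm y" for x y :: 'h
    using rinner_le_norm[of x y] rinner_le_norm[of "- x" y] rinner_scaleR_left[of "-1" x y]
    by simp
  then show "\<exists>K. \<forall>x y :: 'h. norm (rinner x y) \<le> norm x * norm y * K"
    by (intro exI[of _ 1]) simp
qed

lemma norm_diff_square: "(norm (x - y))\<^sup>2 = (norm x)\<^sup>2 - 2 * rinner x y + (norm y)\<^sup>2"
  using norm_add_square[of x "- y"] by (simp add: rinner.minus_right)

text \<open>A minimizing sequence is Cauchy by the parallelogram law, as midpoints stay in
  \<open>C\<close>. Its limit satisfies the variational inequality because moving towards a point of
  \<open>C\<close> cannot decrease the norm. As \<open>C\<close> need not be closed, the limit lies
  only in the closure.\<close>

lemma min_norm_point:
  fixes C :: "'h::chilbert_space set"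
  assumes "convex C" "C \<noteq> {}"
  obtains z where "z \<in> closure C" "\<And>y. y \<in> C \<Longrightarrow> (norm z)\<^sup>2 \<le> rinner z y"
proof -
  define d where "d = Inf (norm ` C)"
  have bdd: "bdd_below (norm ` C)" by (rule bdd_belowI[of _ 0]) auto
  have d_le: "d \<le> norm x" if "x \<in> C" for x
    unfolding d_def using bdd that by (intro cInf_lower) auto
  have d0: "0 \<le> d" unfolding d_def using assms(2) by (intro cInf_greatest) auto
  have "\<exists>x\<in>C. norm x < d + 1 / (real n + 1)" for n
  proof -
    have "\<exists>r\<in>norm ` C. r < d + 1 / (real n + 1)"
      using assms(2) by (intro cInf_lessD) (auto simp: d_def)
    then show ?thesis by auto
  qed
  then obtain x where x: "\<And>n. x n \<in> C" "\<And>n. norm (x n) < d + 1 / (real n + 1)" by metis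
  have lim_norm: "(\<lambda>n. norm (x n)) \<longlonglongrightarrow> d"
  proof (rule tendsto_sandwich[of "\<lambda>_. d" _ _ "\<lambda>n. d + 1 / (real n + 1)"])
    show "(\<lambda>n. d + 1 / (real n + 1)) \<longlonglongrightarrow> d"
      using tendsto_add[OF tendsto_const[of d] LIMSEQ_inverse_real_of_nat]
      by (simp add: inverse_eq_divide add.commute)
  qed (use d_le[OF x(1)] less_imp_le[OF x(2)] in auto)
  have mid: "(norm (u - v))\<^sup>2 \<le> 2 * (norm u)\<^sup>2 + 2 * (norm v)\<^sup>2 - 4 * d\<^sup>2" if "u \<in> C" "v \<in> C" for u v
  proof -
    have "(1/2) *\<^sub>R u + (1/2) *\<^sub>R v \<in> C"
      using assms(1) that by (intro convexD) auto
    then have "d \<le> norm ((1/2) *\<^sub>R (u + v))" using d_le by (simp add: scaleR_add_right)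
    then have "2 * d \<le> norm (u + v)" by simp
    then have "(2 * d)\<^sup>2 \<le> (norm (u + v))\<^sup>2" using d0 by (intro power_mono) auto
    then show ?thesis unfolding norm_add_square norm_diff_square by (simp add: power_mult_distrib)
  qed
  have "Cauchy x"
  proof (rule metric_CauchyI)
    fix r :: real assume r: "r > 0"
    have "(\<lambda>n. 2 * (norm (x n))\<^sup>2) \<longlonglongrightarrow> 2 * d\<^sup>2"
      by (intro tendsto_intros lim_norm)
    then have "eventually (\<lambda>n. 2 * (norm (x n))\<^sup>2 < 2 * d\<^sup>2 + r\<^sup>2 / 2) sequentially"
      by (rule order_tendstoD(2)) (use r in auto)
    then obtain M where M: "\<And>n. n \<ge> M \<Longrightarrow> 2 * (norm (x n))\<^sup>2 < 2 * d\<^sup>2 + r\<^sup>2 / 2"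
      by (auto simp: eventually_sequentially)
    have "dist (x m) (x n) < r" if "m \<ge> M" "n \<ge> M" for m n
    proof -
      have "(norm (x m - x n))\<^sup>2 < r\<^sup>2"
        using mid[OF x(1) x(1), of m n] M[OF that(1)] M[OF that(2)] by linarith
      then show ?thesis using r by (simp add: dist_norm power2_less_imp_less)
    qed
    then show "\<exists>M. \<forall>m\<ge>M. \<forall>n\<ge>M. dist (x m) (x n) < r" by blast
  qed
  then obtain z where z: "x \<longlonglongrightarrow> z" by (auto simp: Cauchy_convergent_iff convergent_def)
  have nz: "norm z = d" using tendsto_norm[OF z] lim_norm LIMSEQ_unique by blast
  show thesis
  proof
    show "z \<in> closure C" using z x(1) closure_sequential by blast
    fix y assume y: "y \<in> C"
    \<comment> \<open>\<open>z\<close> may lie outside \<open>C\<close>, so minimality is used on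
      the segments from \<open>x n\<close> to \<open>y\<close> and passed to the limit. Letting
      \<open>s\<close> tend to \<open>0\<close> then leaves only the first-order term.\<close>
    have ge: "0 \<le> 2 * rinner z (y - z) + s * (norm (y - z))\<^sup>2" if s: "0 < s" "s \<le> 1" for s
    proof -
      have "d \<le> norm (x n + s *\<^sub>R (y - x n))" for n
      proof -
        have "(1 - s) *\<^sub>R x n + s *\<^sub>R y \<in> C"
          using assms(1) s x(1) y by (intro convexD) auto
        then show ?thesis using d_le by (simp add: algebra_simps)
      qed
      moreover have "(\<lambda>n. norm (x n + s *\<^sub>R (y - x n))) \<longlonglongrightarrow> norm (z + s *\<^sub>R (y - z))"
        by (intro tendsto_intros z)
      ultimately have "d \<le> norm (z + s *\<^sub>R (y - z))" by (intro LIMSEQ_le_const) auto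
      then have "(norm z)\<^sup>2 \<le> (norm (z + s *\<^sub>R (y - z)))\<^sup>2" using nz d0 by (intro power_mono) auto
      then have "0 \<le> s * (2 * rinner z (y - z) + s * (norm (y - z))\<^sup>2)"
        unfolding norm_add_square
        by (simp add: rinner.scaleR_right power_mult_distrib distrib_left power2_eq_square ac_simps)
      then show ?thesis using s by (simp add: zero_le_mult_iff)
    qed
    have "((\<lambda>s. 2 * rinner z (y - z) + s * (norm (y - z))\<^sup>2) \<longlongrightarrow> 2 * rinner z (y - z) + 0 * (norm (y - z))\<^sup>2) (at_right 0)"
      by (intro tendsto_intros)
    moreover have "eventually (\<lambda>s. 0 \<le> 2 * rinner z (y - z) + s * (norm (y - z))\<^sup>2) (at_right (0::real))"
      unfolding eventually_at_right_field using ge by (intro exI[of _ 1]) auto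
    ultimately have "0 \<le> 2 * rinner z (y - z) + 0 * (norm (y - z))\<^sup>2"
      by (rule tendsto_lowerbound) simp
    then show "(norm z)\<^sup>2 \<le> rinner z y" by (simp add: rinner.diff_right rinner_self)
  qed
qed

section \<open>Commuting orthogonal projections\<close>

definition ortho_proj :: "('h::chilbert_space \<Rightarrow> 'h) \<Rightarrow> bool" where
  "ortho_proj P \<longleftrightarrow> linear P \<and> (\<forall>x. P (P x) = P x) \<and> (\<forall>x y. rinner (P x) y = rinner x (P y))"

lemma ortho_projD:
  assumes "ortho_proj P"
  shows "linear P" "P (P x) = P x" "rinner (P x) y = rinner x (P y)"
  using assms by (auto simp: ortho_proj_def)

lemma ortho_proj_pythagoras:
  assumes "ortho_proj P"
  shows "(norm x)\<^sup>2 = (norm (P x))\<^sup>2 + (norm (x - P x))\<^sup>2"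
proof -
  have "rinner x (P x) = (norm (P x))\<^sup>2"
    using ortho_projD(3)[OF assms, of x "P x"] by (simp add: ortho_projD(2)[OF assms] rinner_self)
  then show ?thesis by (simp add: norm_diff_square)
qed

lemma ortho_proj_norm_le:
  assumes "ortho_proj P"
  shows "norm (P x) \<le> norm x"
proof (rule power2_le_imp_le)
  show "(norm (P x))\<^sup>2 \<le> (norm x)\<^sup>2"
    by (subst ortho_proj_pythagoras[OF assms, of x]) simp
qed simp

lemma ortho_proj_tendsto:
  assumes "ortho_proj P" "f \<longlonglongrightarrow> l"
  shows "(\<lambda>n. P (f n)) \<longlonglongrightarrow> P l"
proof -
  have "bounded_linear P"
  proof (rule bounded_linear_intro[where K = 1])
    show "norm (P x) \<le> norm x * 1" for x using ortho_proj_norm_le[OF assms(1)] by simp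
  qed (rule linear_add[OF ortho_projD(1)[OF assms(1)]] linear_scale[OF ortho_projD(1)[OF assms(1)]])+
  then show ?thesis using assms(2) bounded_linear.tendsto by blast
qed

section \<open>Products of commuting projections and their limits\<close>

locale commuting_projections =
  fixes p :: "nat \<Rightarrow> 'h::chilbert_space \<Rightarrow> 'h"
  assumes proj: "ortho_proj (p k)"
    and comm: "p i (p j x) = p j (p i x)"
begin

primrec partial_prod :: "nat \<Rightarrow> 'h \<Rightarrow> 'h" where
  "partial_prod 0 x = x"
| "partial_prod (Suc k) x = p k (partial_prod k x)"

lemma partial_prod_comm: "p j (partial_prod k x) = partial_prod k (p j x)"
  by (induction k) (auto simp: comm[of j])

lemma ortho_proj_partial_prod: "ortho_proj (partial_prod k)"
proof (induction k)
  case 0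
  show ?case by (auto simp: ortho_proj_def intro!: linearI)
next
  case (Suc k)
  note pk = ortho_projD[OF proj[of k]] and rk = ortho_projD[OF Suc]
  show ?case unfolding ortho_proj_def
  proof (intro conjI allI)
    have "linear (p k \<circ> partial_prod k)" using pk(1) rk(1) by (rule linear_compose[rotated])
    then show "linear (partial_prod (Suc k))" by (simp add: o_def linear_iff)
  next
    fix x y
    show "partial_prod (Suc k) (partial_prod (Suc k) x) = partial_prod (Suc k) x"
      by (simp add: partial_prod_comm pk rk)
    show "rinner (partial_prod (Suc k) x) y = rinner x (partial_prod (Suc k) y)"
      by (simp add: partial_prod_comm pk rk)
  qed
qed

lemma partial_prod_fixed: "(\<And>j. j < k \<Longrightarrow> p j x = x) \<Longrightarrow> partial_prod k x = x"
  by (induction k) auto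

lemma p_partial_prod: "j < k \<Longrightarrow> p j (partial_prod k x) = partial_prod k x"
  by (induction k) (auto simp: less_Suc_eq ortho_projD[OF proj] comm[of j])

lemma partial_prod_kernel:
  assumes "j < k" "p j x = 0"
  shows "partial_prod k x = 0"
  using p_partial_prod[OF assms(1), of x] assms(2)
  by (simp add: partial_prod_comm linear_0 ortho_projD(1)[OF ortho_proj_partial_prod])

text \<open>Pythagoras, telescoped: each factor splits off an increment orthogonal to what remains.
  The resulting bound on the sum of the squared increments is independent of
  \<open>n\<close>.\<close>

lemma sum_norm_partial_prod_diff:
  "(\<Sum>k<n. (norm (partial_prod k x - partial_prod (Suc k) x))\<^sup>2) + (norm (partial_prod n x))\<^sup>2 = (norm x)\<^sup>2"
proof (induction n)
  case (Suc n)
  then show ?case using ortho_proj_pythagoras[OF proj[of n], of "partial_prod n x"] by simp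
qed simp

text \<open>The squared norms decrease, and the squared distance of two partial products is the
  difference of their squared norms, so the sequence is Cauchy. Its limit is the orthogonal
  projection of \<open>x\<close> onto the common fixed space.\<close>

lemma partial_prod_limit:
  obtains l where "(\<lambda>n. partial_prod n x) \<longlonglongrightarrow> l" "\<And>k. p k l = l"
    "\<And>y. (\<And>k. p k y = y) \<Longrightarrow> rinner l y = rinner x y"
proof -
  define s where "s n = (norm (partial_prod n x))\<^sup>2" for n
  have 1: "(norm (partial_prod m x - partial_prod n x))\<^sup>2 = s m - s n" if "m \<le> n" for m n
  proof -
    have "rinner (partial_prod m x) (partial_prod n x) = rinner x (partial_prod n x)"
      using that by (simp add: ortho_projD(3)[OF ortho_proj_partial_prod] p_partial_prod partial_prod_fixed)
    also have "\<dots> = rinner x (partial_prod n (partial_prod n x))"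
      by (simp add: ortho_projD(2)[OF ortho_proj_partial_prod])
    also have "\<dots> = s n"
      by (simp only: ortho_projD(3)[OF ortho_proj_partial_prod, symmetric] rinner_self s_def)
    finally show ?thesis by (simp add: norm_diff_square s_def)
  qed
  have 2: "(norm (partial_prod m x - partial_prod n x))\<^sup>2 = \<bar>s m - s n\<bar>" for m n
  proof (cases "m \<le> n")
    case True
    then show ?thesis using 1[OF True] zero_le_power2[of "norm (partial_prod m x - partial_prod n x)"] by simp
  next
    case False
    then have "n \<le> m" by simp
    then show ?thesis using 1[of n m] zero_le_power2[of "norm (partial_prod n x - partial_prod m x)"]
      by (simp add: norm_minus_commute)
  qed
  have "decseq s"
  proof (rule decseq_SucI)
    fix n show "s (Suc n) \<le> s n"
      using 1[of n "Suc n"] zero_le_power2[of "norm (partial_prod n x - partial_prod (Suc n) x)"] by simp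
  qed
  then have "convergent s"
    by (rule decseq_convergent[where B = 0]) (auto simp: s_def convergent_def)
  then have "Cauchy s" by (rule convergent_Cauchy)
  have "Cauchy (\<lambda>n. partial_prod n x)"
  proof (rule metric_CauchyI)
    fix r :: real assume r: "r > 0"
    then obtain M where M: "\<And>m n. m \<ge> M \<Longrightarrow> n \<ge> M \<Longrightarrow> \<bar>s m - s n\<bar> < r\<^sup>2"
      using metric_CauchyD[OF \<open>Cauchy s\<close>, of "r\<^sup>2"] by (auto simp: dist_real_def)
    then have "dist (partial_prod m x) (partial_prod n x) < r" if "m \<ge> M" "n \<ge> M" for m n
      using that r 2[of m n] by (simp add: dist_norm power2_less_imp_less)
    then show "\<exists>M. \<forall>m\<ge>M. \<forall>n\<ge>M. dist (partial_prod m x) (partial_prod n x) < r" by blast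
  qed
  then obtain l where l: "(\<lambda>n. partial_prod n x) \<longlonglongrightarrow> l"
    by (auto simp: Cauchy_convergent_iff convergent_def)
  show thesis
  proof
    show "(\<lambda>n. partial_prod n x) \<longlonglongrightarrow> l" by (rule l)
    show "p k l = l" for k
    proof (rule LIMSEQ_unique[OF ortho_proj_tendsto[OF proj l]])
      show "(\<lambda>n. p k (partial_prod n x)) \<longlonglongrightarrow> l"
        by (rule Lim_transform_eventually[OF l])
           (auto simp: eventually_sequentially p_partial_prod intro!: exI[of _ "Suc k"])
    qed
    fix y assume y: "\<And>k. p k y = y"
    have "(\<lambda>n. rinner (partial_prod n x) y) \<longlonglongrightarrow> rinner l y"
      by (intro rinner.tendsto l tendsto_const)
    moreover have "rinner (partial_prod n x) y = rinner x y" for n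
      by (simp add: ortho_projD(3)[OF ortho_proj_partial_prod] partial_prod_fixed y)
    ultimately show "rinner l y = rinner x y" by (simp add: LIMSEQ_const_iff)
  qed
qed

end

section \<open>Affine actions of the integers\<close>

text \<open>\<open>U i x + b i\<close> is the affine action of \<open>i\<close>, and \<open>P i x + e i\<close> is the affine projection onto
  the fixed points of a finite group; the axioms say that these projections commute and that they
  are permuted by the action.\<close>

locale affine_projection_system =
  fixes U P :: "int \<Rightarrow> 'h::chilbert_space \<Rightarrow> 'h" and b e :: "int \<Rightarrow> 'h"
  assumes linear_U: "linear (U i)"
    and norm_U: "norm (U i x) = norm x"
    and U_add: "U (i + j) x = U i (U j x)"
    and b_add: "b (i + j) = b i + U i (b j)"
    and proj_P: "ortho_proj (P i)"
    and P_comm: "P i (P j x) = P j (P i x)"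
    and P_shift: "P (i + j) (U i x) = U i (P j x)"
    and P_e: "P i (e i) = 0"
    and e_comm: "e i + P i (e j) = e j + P j (e i)"
    and e_shift: "e (i + j) + P (i + j) (b i) = b i + U i (e j)"
begin

lemmas U_simps = linear_add[OF linear_U] linear_diff[OF linear_U] linear_scale[OF linear_U]
  linear_0[OF linear_U] linear_sum[OF linear_U]

lemmas P_simps = linear_add[OF ortho_projD(1)[OF proj_P]] linear_diff[OF ortho_projD(1)[OF proj_P]]
  linear_scale[OF ortho_projD(1)[OF proj_P]] linear_0[OF ortho_projD(1)[OF proj_P]]
  linear_sum[OF ortho_projD(1)[OF proj_P]] ortho_projD(2)[OF proj_P]

lemma U_0: "U 0 x = x"
proof -
  have "U 0 (U 0 x - x) = 0" using U_add[of 0 0 x] by (simp add: U_simps)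
  then show ?thesis using norm_U[of 0 "U 0 x - x"] by simp
qed

lemma b_0: "b 0 = 0"
  using b_add[of 0 0] by (simp add: U_0)

lemma b_int_sum: "b (int n) = (\<Sum>i<n. U (int i) (b 1))"
proof (induction n)
  case (Suc n)
  then show ?case using b_add[of "int n" 1] by (simp add: add.commute)
qed (simp add: b_0)

text \<open>The action moves \<open>e 0\<close> to the point \<open>b j + U j (e 0)\<close> fixed by
  the \<open>j\<close>-th affine projection; subtracting \<open>P j (b j)\<close> turns it into the
  fixed point nearest to the origin, which is \<open>e j\<close>.\<close>

lemma e_eq: "e j = U j (e 0) + (b j - P j (b j))"
  using e_shift[of j 0] by (simp add: algebra_simps)

section \<open>The affine action and its displacements\<close>

definition T :: "int \<Rightarrow> 'h \<Rightarrow> 'h" where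
  "T i x = b i + U i x"

lemma T_add: "T (i + j) x = T i (T j x)"
  by (simp add: T_def b_add U_add U_simps)

lemma T_0: "T 0 x = x"
  by (simp add: T_def b_0 U_0)

lemma norm_T_diff: "norm (T i x - T i y) = norm (x - y)"
  by (simp add: T_def U_simps[symmetric] norm_U)

lemma norm_T_int_minus_le: "norm (T (int n) x - x) \<le> real n * norm (T 1 x - x)"
proof (induction n)
  case 0
  show ?case by (simp add: T_0)
next
  case (Suc n)
  have "T (int (Suc n)) x - x = (T (int n) (T 1 x) - T (int n) x) + (T (int n) x - x)"
    by (simp add: T_add[symmetric] add.commute)
  then have "norm (T (int (Suc n)) x - x) \<le> norm (T 1 x - x) + norm (T (int n) x - x)"
    by (metis norm_triangle_ineq norm_T_diff)
  then show ?case using Suc by (simp add: algebra_simps)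
qed

lemma norm_T_minus_le: "norm (T i x - x) \<le> \<bar>real_of_int i\<bar> * norm (T 1 x - x)"
proof (cases "i \<ge> 0")
  case True
  then show ?thesis using norm_T_int_minus_le[of "nat i" x] by simp
next
  case False
  have "norm (T i x - x) = norm (T (- i) (T i x) - T (- i) x)" by (simp only: norm_T_diff)
  also have "\<dots> = norm (T (- i) x - x)"
    by (simp add: T_add[symmetric] T_0 norm_minus_commute)
  finally show ?thesis using norm_T_int_minus_le[of "nat (- i)" x] False by simp
qed

lemma norm_b_le: "norm (b i) \<le> \<bar>real_of_int i\<bar> * norm (b 1)"
  using norm_T_minus_le[of i 0] by (simp add: T_def U_simps)

text \<open>\<open>e_shift\<close> and \<open>P_shift\<close> together say that \<open>T i\<close>
  conjugates the \<open>j\<close>-th affine projection to the one of index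
  \<open>i + j\<close>.\<close>

lemma T_fixed:
  assumes "e j + P j x = x"
  shows "e (i + j) + P (i + j) (T i x) = T i x"
proof -
  have "e (i + j) + P (i + j) (T i x) = (e (i + j) + P (i + j) (b i)) + U i (P j x)"
    by (simp add: T_def P_simps P_shift)
  also have "\<dots> = b i + U i (e j + P j x)" by (simp add: e_shift U_simps)
  finally show ?thesis by (simp add: assms T_def)
qed

section \<open>Common fixed points of consecutive affine projections\<close>

sublocale nonneg: commuting_projections "\<lambda>k. P (int k)"
  by unfold_locales (auto simp: proj_P P_comm)

text \<open>\<open>R n\<close> projects onto the vectors fixed by
  \<open>P 0, ..., P (n - 1)\<close>; windows that contain negative indices are reached later by
  translating with \<open>T\<close>.\<close>

abbreviation R :: "nat \<Rightarrow> 'h \<Rightarrow> 'h" where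
  "R \<equiv> nonneg.partial_prod"

lemmas R_proj = ortho_projD[OF nonneg.ortho_proj_partial_prod]

lemmas R_simps = linear_add[OF R_proj(1)] linear_diff[OF R_proj(1)] linear_0[OF R_proj(1)]
  linear_sum[OF R_proj(1)]

text \<open>This is the image of \<open>0\<close> under the affine projections of indices \<open>0, \<dots>, n - 1\<close>.\<close>

definition v :: "nat \<Rightarrow> 'h" where
  "v n = (\<Sum>k<n. R k (e (int k)))"

text \<open>The defect of \<open>v n\<close> from being fixed by the \<open>j\<close>-th affine
  projection is \<open>R n (e j)\<close>, which vanishes once \<open>P j\<close> is a factor of
  \<open>R n\<close>. In the induction, \<open>e_comm\<close> lets the increments telescope.\<close>

lemma v_minus_P_v: "v n - P j (v n) = e j - R n (e j)"
proof (induction n)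
  case 0
  show ?case by (simp add: v_def P_simps)
next
  case (Suc n)
  have PR: "P j (R n x) = R n (P j x)" for x
    by (induction n) (auto simp: P_comm[of j])
  have "v (Suc n) - P j (v (Suc n)) = (v n - P j (v n)) + R n (e (int n) - P j (e (int n)))"
    by (simp add: v_def P_simps PR R_simps)
  also have "e (int n) - P j (e (int n)) = e j - P (int n) (e j)"
    using e_comm[of "int n" j] by (simp add: algebra_simps)
  finally show ?case
    by (simp add: Suc R_simps nonneg.partial_prod_comm)
qed

lemma v_fixed: "j < n \<Longrightarrow> e (int j) + P (int j) (v n) = v n"
  using v_minus_P_v[of n "int j"] nonneg.partial_prod_kernel[OF _ P_e, of j n]
  by (simp add: algebra_simps)

text \<open>\<open>R n\<close> contains each \<open>P (int k)\<close> with \<open>k < n\<close> as a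
  factor, which kills \<open>e (int k)\<close>. Hence \<open>R n (v n) = 0\<close>, and the next
  summand, lying in the range of \<open>R n\<close>, is orthogonal to \<open>v n\<close>.\<close>

lemma norm_v_square: "(norm (v n))\<^sup>2 = (\<Sum>k<n. (norm (R k (e (int k))))\<^sup>2)"
proof (induction n)
  case (Suc n)
  have "R n (v n) = 0"
  proof (induction n)
    case (Suc n)
    have "R (Suc n) (v (Suc n)) = P (int n) (R n (v n)) + R n (R n (P (int n) (e (int n))))"
      by (simp add: v_def R_simps(1) P_simps(1) nonneg.partial_prod_comm)
    then show ?case by (simp add: Suc P_e R_simps P_simps)
  qed (simp add: v_def)
  then have "rinner (v n) (R n (e (int n))) = 0"
    by (simp add: R_proj(3)[symmetric] rinner.zero_left)
  then have "(norm (v (Suc n)))\<^sup>2 = (norm (v n))\<^sup>2 + (norm (R n (e (int n))))\<^sup>2"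
    by (simp add: v_def norm_add_square)
  then show ?case using Suc by simp
qed (simp add: v_def)

text \<open>\<open>b (int k)\<close> is a sum of \<open>k\<close> translates of \<open>b 1\<close>,
  to which Cauchy-Schwarz applies. Extending the range from \<open>k\<close> to \<open>n\<close>
  makes it independent of \<open>k\<close>, so that two sums can be swapped later.\<close>

lemma norm_R_diff_square_le:
  assumes "k \<le> n"
  shows "(norm (R k (b (int k)) - R (Suc k) (b (int k))))\<^sup>2
    \<le> real n * (\<Sum>i<n. (norm (R k (U (int i) (b 1)) - R (Suc k) (U (int i) (b 1))))\<^sup>2)"
proof -
  let ?q = "\<lambda>i. norm (R k (U (int i) (b 1)) - R (Suc k) (U (int i) (b 1)))"
  have "norm (R k (b (int k)) - R (Suc k) (b (int k))) \<le> (\<Sum>i<k. ?q i)"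
    unfolding b_int_sum R_simps sum_subtractf[symmetric] by (rule norm_sum)
  also have "\<dots> \<le> (\<Sum>i<n. ?q i)" using assms by (intro sum_mono2) auto
  finally have "(norm (R k (b (int k)) - R (Suc k) (b (int k))))\<^sup>2 \<le> (\<Sum>i<n. ?q i)\<^sup>2"
    by (intro power_mono) auto
  also have "\<dots> \<le> (\<Sum>i<n. (?q i)\<^sup>2) * real (card {..<n})"
    by (rule sum_squared_le_sum_of_squares)
  finally show ?thesis by (simp add: mult.commute)
qed

text \<open>The naive bound on the summands is linear in \<open>k\<close> and would only give \<open>n powr (3/2)\<close>;
  orthogonality of the increments \<open>R k - R (Suc k)\<close> brings the growth down to linear.\<close>

lemma norm_v_le: "norm (v n) \<le> real n * sqrt (2 * (norm (e 0))\<^sup>2 + 2 * (norm (b 1))\<^sup>2)"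
proof (cases "n = 0")
  case True
  then show ?thesis by (simp add: v_def)
next
  case False
  let ?q = "\<lambda>k x. norm (R k x - R (Suc k) x)"
  have 1: "(norm (R k (e (int k))))\<^sup>2 \<le> 2 * (norm (e 0))\<^sup>2 + 2 * (?q k (b (int k)))\<^sup>2" for k
  proof -
    have "R k (e (int k)) = R k (U (int k) (e 0)) + (R k (b (int k)) - R (Suc k) (b (int k)))"
      by (subst e_eq) (simp add: R_simps nonneg.partial_prod_comm)
    then have "norm (R k (e (int k))) \<le> norm (e 0) + ?q k (b (int k))"
      by (metis norm_triangle_le add_mono order_refl norm_U
            ortho_proj_norm_le[OF nonneg.ortho_proj_partial_prod])
    then have "(norm (R k (e (int k))))\<^sup>2 \<le> (norm (e 0) + ?q k (b (int k)))\<^sup>2"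
      by (intro power_mono) auto
    also have "\<dots> \<le> 2 * (norm (e 0))\<^sup>2 + 2 * (?q k (b (int k)))\<^sup>2"
      using sum_squares_bound[of "norm (e 0)" "?q k (b (int k))"] by (simp add: power2_sum)
    finally show ?thesis .
  qed
  have 2: "(\<Sum>k<n. (?q k (b (int k)))\<^sup>2) \<le> (real n)\<^sup>2 * (norm (b 1))\<^sup>2"
  proof -
    have "(\<Sum>k<n. (?q k (b (int k)))\<^sup>2)
        \<le> (\<Sum>k<n. real n * (\<Sum>i<n. (?q k (U (int i) (b 1)))\<^sup>2))"
      by (intro sum_mono norm_R_diff_square_le) auto
    \<comment> \<open>For fixed \<open>i\<close>, the inner sum now collects the increments of a
      single vector of norm \<open>norm (b 1)\<close>.\<close>
    also have "\<dots> = real n * (\<Sum>i<n. \<Sum>k<n. (?q k (U (int i) (b 1)))\<^sup>2)"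
      unfolding sum_distrib_left[symmetric] by (subst sum.swap) simp
    also have "\<dots> \<le> real n * (\<Sum>i<n. (norm (b 1))\<^sup>2)"
    proof (intro mult_left_mono sum_mono)
      fix i
      show "(\<Sum>k<n. (?q k (U (int i) (b 1)))\<^sup>2) \<le> (norm (b 1))\<^sup>2"
        using nonneg.sum_norm_partial_prod_diff[of "U (int i) (b 1)" n]
          zero_le_power2[of "norm (R n (U (int i) (b 1)))"] unfolding norm_U by linarith
    qed simp
    finally show ?thesis by (simp add: power2_eq_square)
  qed
  have "(norm (v n))\<^sup>2 \<le> (\<Sum>k<n. 2 * (norm (e 0))\<^sup>2 + 2 * (?q k (b (int k)))\<^sup>2)"
    unfolding norm_v_square by (intro sum_mono 1)
  also have "\<dots> = 2 * real n * (norm (e 0))\<^sup>2 + 2 * (\<Sum>k<n. (?q k (b (int k)))\<^sup>2)"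
    by (simp add: sum.distrib sum_distrib_left)
  also have "\<dots> \<le> 2 * (real n)\<^sup>2 * (norm (e 0))\<^sup>2 + 2 * ((real n)\<^sup>2 * (norm (b 1))\<^sup>2)"
    using False by (intro add_mono mult_mono 2) (auto simp: power2_eq_square intro: sum_nonneg)
  also have "\<dots> = (real n * sqrt (2 * (norm (e 0))\<^sup>2 + 2 * (norm (b 1))\<^sup>2))\<^sup>2"
    by (simp add: power_mult_distrib algebra_simps)
  finally show ?thesis by (rule power2_le_imp_le) simp
qed

text \<open>Averaging \<open>n\<close> successive translates of a common fixed point makes the
  displacement telescope to \<open>(u n - u 0) /\<^sub>R real n\<close>, which is bounded by the
  linear growth of \<open>v\<close> and \<open>b\<close>. Both endpoints are fixed by the same
  affine projections, so their difference is fixed by the linear ones.\<close>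

lemma almost_fixed_displacements:
  obtains M where "\<And>n. n > 0 \<Longrightarrow> \<exists>w. e 0 + P 0 w = w \<and> norm (T 1 w - w) \<le> M \<and>
    (\<forall>j. - int n \<le> j \<and> j < int n \<longrightarrow> P j (T 1 w - w) = T 1 w - w)"
proof
  define s where "s = sqrt (2 * (norm (e 0))\<^sup>2 + 2 * (norm (b 1))\<^sup>2)"
  fix n :: nat assume n: "n > 0"
  \<comment> \<open>The \<open>4 * n\<close> indices of affine projections known to fix
    \<open>u k\<close> start at \<open>int k - 2 * int n\<close>. For \<open>k \<le> n\<close> they
    include all indices from \<open>- int n\<close> to \<open>int n - 1\<close>.\<close>
  define u where "u k = T (int k - 2 * int n) (v (4 * n))" for k
  define w where "w = (\<Sum>k<n. u k) /\<^sub>R real n"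
  have u_fixed: "e j + P j (u k) = u k"
    if "int k - 2 * int n \<le> j" "j < 2 * int n + int k" for j k
    using that T_fixed[OF v_fixed[of "nat (j - (int k - 2 * int n))" "4 * n"], of "int k - 2 * int n"]
    by (simp add: u_def nat_less_iff)
  have sum_u_fixed: "real n *\<^sub>R e j + P j (\<Sum>k<n. u k) = (\<Sum>k<n. u k)" if "j = 0" for j
  proof -
    have "(\<Sum>k<n. e j + P j (u k)) = (\<Sum>k<n. u k)"
      by (intro sum.cong refl u_fixed) (use that in auto)
    then show ?thesis by (simp add: sum.distrib P_simps sum_constant_scaleR)
  qed
  have w_fixed: "e 0 + P 0 w = w"
    using arg_cong[OF sum_u_fixed[OF refl], of "\<lambda>x. x /\<^sub>R real n"] n
    by (simp add: w_def P_simps scaleR_add_right)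
  have T_u: "T 1 (u k) = u (Suc k)" for k
    by (simp add: u_def T_add[symmetric] algebra_simps)
  have "T 1 w = (\<Sum>k<n. T 1 (u k)) /\<^sub>R real n"
    using n by (simp add: T_def w_def U_simps sum.distrib scaleR_add_right sum_constant_scaleR)
  then have disp: "T 1 w - w = (u n - u 0) /\<^sub>R real n"
    using sum_lessThan_telescope[of u n]
    by (simp add: T_u w_def scaleR_diff_right[symmetric] sum_subtractf[symmetric])
  have disp_fixed: "P j (T 1 w - w) = T 1 w - w" if "- int n \<le> j" "j < int n" for j
  proof -
    have "P j (u n) = u n - e j" "P j (u 0) = u 0 - e j"
      using u_fixed[of n j] u_fixed[of 0 j] that by (auto simp: eq_diff_eq add.commute)
    then have "P j (u n - u 0) = u n - u 0" by (simp add: P_simps)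
    then show ?thesis by (simp add: disp P_simps)
  qed
  let ?a = "U (- int n) (v (4 * n))" and ?b = "U (- int (2 * n)) (v (4 * n))"
  have "u n - u 0 = b (- int n) - b (- int (2 * n)) + (?a - ?b)"
    by (simp add: u_def T_def)
  then have "norm (u n - u 0) \<le> norm (b (- int n)) + norm (b (- int (2 * n))) + (norm ?a + norm ?b)"
    by (metis norm_triangle_le add_mono norm_triangle_ineq4)
  also have "\<dots> \<le> real n * norm (b 1) + real (2 * n) * norm (b 1)
      + (real (4 * n) * s + real (4 * n) * s)"
    unfolding norm_U s_def using norm_b_le[of "- int n"] norm_b_le[of "- int (2 * n)"]
    by (intro add_mono norm_v_le) simp_all
  also have "\<dots> = real n * (3 * norm (b 1) + 8 * s)" by (simp add: algebra_simps)
  finally have "norm (u n - u 0) / real n \<le> 3 * norm (b 1) + 8 * s"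
    using n by (simp add: divide_le_eq mult.commute)
  then have "norm (T 1 w - w) \<le> 3 * norm (b 1) + 8 * s"
    by (simp add: disp divide_inverse mult.commute)
  then show "\<exists>w. e 0 + P 0 w = w \<and> norm (T 1 w - w)
      \<le> 3 * norm (b 1) + 8 * sqrt (2 * (norm (e 0))\<^sup>2 + 2 * (norm (b 1))\<^sup>2) \<and>
    (\<forall>j. - int n \<le> j \<and> j < int n \<longrightarrow> P j (T 1 w - w) = T 1 w - w)"
    using w_fixed disp_fixed unfolding s_def by blast
qed

text \<open>A nonzero displacement of minimal norm pairs to a positive constant with all displacements, in
  particular with bounded ones fixed by more and more \<open>P j\<close>; so its projection to the common fixed
  space of the \<open>P j\<close> does not vanish, and minimality makes this projection invariant.\<close>

lemma almost_fixed_point: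
  assumes no_inv: "\<And>z. P 0 z = z \<Longrightarrow> U 1 z = z \<Longrightarrow> z = 0" and "r > 0"
  obtains w where "e 0 + P 0 w = w" "norm (T 1 w - w) < r"
proof -
  define C where "C = {T 1 w - w | w. e 0 + P 0 w = w}"
  have "convex C"
  proof (rule convexI)
    fix x y :: 'h and s t :: real assume xy: "x \<in> C" "y \<in> C" and st: "0 \<le> s" "0 \<le> t" "s + t = 1"
    from xy obtain w w' where w: "x = T 1 w - w" "e 0 + P 0 w = w" "y = T 1 w' - w'" "e 0 + P 0 w' = w'"
      unfolding C_def by blast
    have aff: "c = s *\<^sub>R c + t *\<^sub>R c" for c :: 'h
      using st(3) by (simp add: scaleR_add_left[symmetric])
    have "e 0 + P 0 (s *\<^sub>R w + t *\<^sub>R w') = s *\<^sub>R (e 0 + P 0 w) + t *\<^sub>R (e 0 + P 0 w')"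
      by (subst aff[of "e 0"]) (simp add: P_simps scaleR_add_right)
    moreover have "s *\<^sub>R x + t *\<^sub>R y = T 1 (s *\<^sub>R w + t *\<^sub>R w') - (s *\<^sub>R w + t *\<^sub>R w')"
      unfolding w T_def by (subst (3) aff[of "b 1"]) (simp add: U_simps scaleR_add_right scaleR_diff_right)
    ultimately show "s *\<^sub>R x + t *\<^sub>R y \<in> C" unfolding C_def using w by auto
  qed
  have v1: "e 0 + P 0 (v 1) = v 1" using v_fixed[of 0 1] by simp
  then have "C \<noteq> {}" unfolding C_def by blast
  then obtain z where z: "z \<in> closure C" "\<And>y. y \<in> C \<Longrightarrow> (norm z)\<^sup>2 \<le> rinner z y"
    using min_norm_point \<open>convex C\<close> by blast
  \<comment> \<open>Adding multiples of \<open>x\<close> to a fixed point moves its displacement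
    along a whole line inside \<open>C\<close>, on which the pairing with \<open>z\<close> is
    bounded below.\<close>
  have z_orth: "rinner z (U 1 x - x) = 0" if x: "P 0 x = x" for x
  proof (rule ccontr)
    assume nz: "rinner z (U 1 x - x) \<noteq> 0"
    \<comment> \<open>Chosen so that the pairing becomes
      \<open>(norm z)\<^sup>2 - 1\<close>.\<close>
    define s where "s = ((norm z)\<^sup>2 - rinner z (T 1 (v 1) - v 1) - 1) / rinner z (U 1 x - x)"
    have "e 0 + P 0 (v 1 + s *\<^sub>R x) = v 1 + s *\<^sub>R x"
      using v1 x by (simp add: P_simps add.assoc[symmetric])
    then have "T 1 (v 1 + s *\<^sub>R x) - (v 1 + s *\<^sub>R x) \<in> C" unfolding C_def by blast
    moreover have "T 1 (v 1 + s *\<^sub>R x) - (v 1 + s *\<^sub>R x) = (T 1 (v 1) - v 1) + s *\<^sub>R (U 1 x - x)"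
      by (simp add: T_def U_simps algebra_simps)
    ultimately have "(norm z)\<^sup>2 \<le> rinner z (T 1 (v 1) - v 1) + s * rinner z (U 1 x - x)"
      using z(2) by (metis rinner.add_right rinner.scaleR_right real_scaleR_def)
    then show False using nz by (simp add: s_def)
  qed
  have "z = 0"
  proof -
    \<comment> \<open>\<open>int_decode\<close> enumerates all integers, so that the common fixed
      space is mapped into itself by \<open>U 1\<close>.\<close>
    interpret two_sided: commuting_projections "\<lambda>k. P (int_decode k)"
      by unfold_locales (auto simp: proj_P P_comm)
    obtain l where l: "(\<lambda>n. two_sided.partial_prod n z) \<longlonglongrightarrow> l" "\<And>k. P (int_decode k) l = l"
      "\<And>y. (\<And>k. P (int_decode k) y = y) \<Longrightarrow> rinner l y = rinner z y"
      using two_sided.partial_prod_limit by blast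
    have l_fixed: "P j l = l" for j using l(2)[of "int_encode j"] by simp
    have "P j (U 1 l) = U 1 l" for j
      using P_shift[of 1 "j - 1" l] l_fixed by simp
    \<comment> \<open>On the common fixed space, pairing with \<open>l\<close> agrees with pairing
      with \<open>z\<close>. So \<open>l\<close> is orthogonal to \<open>U 1 l - l\<close>, which
      forces \<open>U 1 l = l\<close> as \<open>U 1\<close> preserves norms.\<close>
    then have "rinner l (U 1 l - l) = rinner z (U 1 l - l)"
      by (intro l(3)) (simp add: P_simps l_fixed)
    also have "\<dots> = 0" by (intro z_orth l_fixed)
    finally have "(norm (U 1 l - l))\<^sup>2 = 0"
      unfolding norm_diff_square norm_U using rinner_commute[of l "U 1 l"]
      by (simp add: rinner.diff_right rinner_self)
    then have "l = 0" using no_inv l_fixed by simp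
    obtain M where M: "\<And>n. n > 0 \<Longrightarrow> \<exists>w. e 0 + P 0 w = w \<and> norm (T 1 w - w) \<le> M \<and>
      (\<forall>j. - int n \<le> j \<and> j < int n \<longrightarrow> P j (T 1 w - w) = T 1 w - w)"
      using almost_fixed_displacements by blast
    have "(norm z)\<^sup>2 \<le> norm (two_sided.partial_prod m z) * M" for m
    proof -
      \<comment> \<open>Large enough that the first \<open>m\<close> decoded indices lie in the
        window; \<open>Suc\<close> serves the strict upper bound and the positivity of
        \<open>n\<close>.\<close>
      define n where "n = Suc (\<Sum>k<m. nat \<bar>int_decode k\<bar>)"
      have n: "- int n \<le> int_decode k \<and> int_decode k < int n" if "k < m" for k
      proof -
        have "nat \<bar>int_decode k\<bar> \<le> (\<Sum>k<m. nat \<bar>int_decode k\<bar>)"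
          using that by (intro member_le_sum) auto
        then show ?thesis unfolding n_def by linarith
      qed
      obtain w where w: "e 0 + P 0 w = w" "norm (T 1 w - w) \<le> M"
        "\<And>j. - int n \<le> j \<Longrightarrow> j < int n \<Longrightarrow> P j (T 1 w - w) = T 1 w - w"
        using M[of n] by (auto simp: n_def)
      have "(norm z)\<^sup>2 \<le> rinner z (T 1 w - w)" using z(2) w(1) unfolding C_def by blast
      also have "\<dots> = rinner (two_sided.partial_prod m z) (T 1 w - w)"
        using n w(3) ortho_projD(3)[OF two_sided.ortho_proj_partial_prod]
        by (simp add: two_sided.partial_prod_fixed)
      also have "\<dots> \<le> norm (two_sided.partial_prod m z) * norm (T 1 w - w)"
        by (rule rinner_le_norm)
      also have "\<dots> \<le> norm (two_sided.partial_prod m z) * M"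
        by (intro mult_left_mono w(2)) simp
      finally show ?thesis .
    qed
    moreover have "(\<lambda>m. norm (two_sided.partial_prod m z) * M) \<longlonglongrightarrow> norm l * M"
      by (intro tendsto_intros l(1))
    ultimately have "(norm z)\<^sup>2 \<le> norm l * M" by (intro LIMSEQ_le_const) auto
    then show "z = 0" using \<open>l = 0\<close> by simp
  qed
  then obtain y where "y \<in> C" "norm y < r"
    using z(1) \<open>r > 0\<close> by (auto simp: closure_approachable dist_norm)
  then show thesis using that unfolding C_def by blast
qed

end

section \<open>Averages over finite subgroups\<close>

definition average :: "'a set \<Rightarrow> ('a \<Rightarrow> 'h::real_vector) \<Rightarrow> 'h" where
  "average A f = (\<Sum>a\<in>A. f a) /\<^sub>R real (card A)"

lemma average_cong: "(\<And>a. a \<in> A \<Longrightarrow> f a = g a) \<Longrightarrow> average A f = average A g"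
  by (simp add: average_def)

lemma average_add: "average A (\<lambda>a. f a + g a) = average A f + average A g"
  by (simp add: average_def sum.distrib scaleR_add_right)

lemma average_diff: "average A (\<lambda>a. f a - g a) = average A f - average A g"
  by (simp add: average_def sum_subtractf scaleR_diff_right)

lemma average_const: "finite A \<Longrightarrow> A \<noteq> {} \<Longrightarrow> average A (\<lambda>_. c) = c"
  by (simp add: average_def sum_constant_scaleR)

lemma average_linear: "linear f \<Longrightarrow> f (average A g) = average A (\<lambda>a. f (g a))"
  by (simp add: average_def linear_scale linear_sum)

lemma average_reindex: "bij_betw h A B \<Longrightarrow> average B f = average A (\<lambda>a. f (h a))"
  by (simp add: average_def sum.reindex_bij_betw bij_betw_same_card)

section \<open>Affine projections attached to a unitary cocycle\<close>

locale unitary_cocycle = group G for G :: "('g, 'b) monoid_scheme" (structure) +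
  fixes \<pi> :: "'g \<Rightarrow> 'h::chilbert_space \<Rightarrow> 'h" and b :: "'g \<Rightarrow> 'h"
  assumes rep: "unitary_rep G \<pi>" and cocycle_b: "cocycle G \<pi> b"
begin

lemma rep_mult: "g \<in> carrier G \<Longrightarrow> h \<in> carrier G \<Longrightarrow> \<pi> (g \<otimes> h) x = \<pi> g (\<pi> h x)"
  using rep by (auto simp: unitary_rep_def)

lemma rep_one: "\<pi> \<one> x = x"
  using rep by (auto simp: unitary_rep_def)

lemma cocycle_mult: "g \<in> carrier G \<Longrightarrow> h \<in> carrier G \<Longrightarrow> b (g \<otimes> h) = b g + \<pi> g (b h)"
  using cocycle_b by (auto simp: cocycle_def)

lemma linear_rep:
  assumes "g \<in> carrier G"
  shows "linear (\<pi> g)"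
  using rep assms by (auto simp: unitary_rep_def unitary_operator_def scaleR_scaleC intro!: linearI)

lemma rinner_rep:
  assumes "g \<in> carrier G"
  shows "rinner (\<pi> g x) (\<pi> g y) = rinner x y"
  using rep assms by (auto simp: unitary_rep_def unitary_operator_def rinner_def)

lemma norm_rep: "g \<in> carrier G \<Longrightarrow> norm (\<pi> g x) = norm x"
  using rinner_rep[of g x x] by (simp add: rinner_self)

lemma rep_inv: "g \<in> carrier G \<Longrightarrow> \<pi> (inv g) (\<pi> g x) = x" "g \<in> carrier G \<Longrightarrow> \<pi> g (\<pi> (inv g) x) = x"
  by (simp_all add: rep_mult[symmetric] rep_one)

definition proj :: "'g set \<Rightarrow> 'h \<Rightarrow> 'h" where
  "proj A x = average A (\<lambda>a. \<pi> a x)"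

text \<open>\<open>b a\<close> is the image of \<open>0\<close> under the affine action of
  \<open>a\<close>, so for a finite subgroup this is the barycenter of the orbit of
  \<open>0\<close>.\<close>

definition center :: "'g set \<Rightarrow> 'h" where
  "center A = average A b"

definition finite_subgroup :: "'g set \<Rightarrow> bool" where
  "finite_subgroup A \<longleftrightarrow> finite A \<and> subgroup A G"

lemma finite_subgroupD:
  assumes "finite_subgroup A"
  shows "finite A" "A \<noteq> {}" "a \<in> A \<Longrightarrow> a \<in> carrier G" "a \<in> A \<Longrightarrow> inv a \<in> A"
    "a \<in> A \<Longrightarrow> a' \<in> A \<Longrightarrow> a \<otimes> a' \<in> A"
  using assms subgroup.mem_carrier subgroup.one_closed[of A G] subgroup.m_inv_closed[of A G]
    subgroup.m_closed[of A G] by (auto simp: finite_subgroup_def)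

lemma bij_betw_left_mult:
  assumes "finite_subgroup A" "g \<in> A"
  shows "bij_betw (\<lambda>a. g \<otimes> a) A A"
  by (rule bij_betw_byWitness[where f' = "\<lambda>a. inv g \<otimes> a"])
     (use assms finite_subgroupD[OF assms(1)] in \<open>auto simp: m_assoc[symmetric]\<close>)

lemma bij_betw_inv:
  assumes "finite_subgroup A"
  shows "bij_betw (\<lambda>a. inv a) A A"
  by (rule bij_betw_byWitness[where f' = "\<lambda>a. inv a"]) (use finite_subgroupD[OF assms] in auto)

lemma linear_proj:
  assumes "finite_subgroup A"
  shows "linear (proj A)"
proof (rule linearI)
  note l = linear_rep[OF finite_subgroupD(3)[OF assms]]
  show "proj A (x + y) = proj A x + proj A y" for x y
    unfolding proj_def average_add[symmetric] by (intro average_cong linear_add[OF l])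
  show "proj A (c *\<^sub>R x) = c *\<^sub>R proj A x" for c x
  proof -
    have "proj A (c *\<^sub>R x) = average A (\<lambda>a. c *\<^sub>R \<pi> a x)"
      unfolding proj_def by (intro average_cong linear_scale[OF l])
    then show ?thesis by (simp add: proj_def average_linear[OF linear_scaleR])
  qed
qed

lemma rep_proj:
  assumes "finite_subgroup A" "g \<in> A"
  shows "\<pi> g (proj A x) = proj A x"
proof -
  note A = finite_subgroupD[OF assms(1)]
  have "\<pi> g (proj A x) = average A (\<lambda>a. \<pi> g (\<pi> a x))"
    unfolding proj_def by (intro average_linear linear_rep A assms)
  also have "\<dots> = average A (\<lambda>a. \<pi> (g \<otimes> a) x)"
    by (intro average_cong) (simp add: rep_mult A assms)
  also have "\<dots> = proj A x"
    unfolding proj_def using average_reindex[OF bij_betw_left_mult[OF assms], of "\<lambda>a. \<pi> a x"] by simp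
  finally show ?thesis .
qed

lemma proj_fixed:
  assumes "finite_subgroup A" "\<And>g. g \<in> A \<Longrightarrow> \<pi> g x = x"
  shows "proj A x = x"
proof -
  have "proj A x = average A (\<lambda>_. x)" unfolding proj_def by (intro average_cong assms)
  then show ?thesis using finite_subgroupD[OF assms(1)] by (simp add: average_const)
qed

lemma ortho_proj_proj:
  assumes "finite_subgroup A"
  shows "ortho_proj (proj A)"
  unfolding ortho_proj_def
proof (intro conjI allI)
  note A = finite_subgroupD[OF assms]
  show "linear (proj A)" by (rule linear_proj[OF assms])
  show "proj A (proj A x) = proj A x" for x by (intro proj_fixed rep_proj assms)
  show "rinner (proj A x) y = rinner x (proj A y)" for x y
  proof -
    have "rinner (proj A x) y = average A (\<lambda>a. rinner (\<pi> a x) y)"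
      unfolding proj_def by (intro average_linear[of "\<lambda>z. rinner z y"] bounded_linear.linear rinner.bounded_linear_left)
    also have "\<dots> = average A (\<lambda>a. rinner x (\<pi> (inv a) y))"
    proof (intro average_cong)
      fix a assume "a \<in> A"
      then show "rinner (\<pi> a x) y = rinner x (\<pi> (inv a) y)"
        using rinner_rep[of "inv a" "\<pi> a x" y] A by (simp add: rep_inv)
    qed
    also have "\<dots> = average A (\<lambda>a. rinner x (\<pi> a y))"
      using average_reindex[OF bij_betw_inv[OF assms], of "\<lambda>a. rinner x (\<pi> a y)"] by simp
    also have "\<dots> = rinner x (proj A y)"
      unfolding proj_def by (intro average_linear[symmetric] bounded_linear.linear rinner.bounded_linear_right)
    finally show ?thesis .
  qed
qed

text \<open>Left multiplication by \<open>g\<close> permutes \<open>A\<close>, so the affine action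
  of \<open>g\<close> permutes the orbit of \<open>0\<close> and fixes its barycenter.\<close>

lemma center_fixed:
  assumes "finite_subgroup A" "g \<in> A"
  shows "b g + \<pi> g (center A) = center A"
proof -
  note A = finite_subgroupD[OF assms(1)]
  have "center A = average A (\<lambda>a. b (g \<otimes> a))"
    unfolding center_def using average_reindex[OF bij_betw_left_mult[OF assms], of b] by simp
  also have "\<dots> = average A (\<lambda>a. b g + \<pi> g (b a))"
    by (intro average_cong cocycle_mult A assms)
  also have "\<dots> = b g + \<pi> g (center A)"
    unfolding average_add center_def
    by (simp add: average_const A average_linear[OF linear_rep[OF A(3)[OF assms(2)]]])
  finally show ?thesis ..
qed

text \<open>By \<open>center_fixed\<close>, each \<open>\<pi> g\<close> sends the center to
  \<open>center A - b g\<close>, and the average of \<open>b\<close> is the center again.\<close>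

lemma proj_center:
  assumes "finite_subgroup A"
  shows "proj A (center A) = 0"
proof -
  note A = finite_subgroupD[OF assms]
  have "proj A (center A) = average A (\<lambda>g. center A - b g)"
    unfolding proj_def using center_fixed[OF assms]
    by (intro average_cong) (simp add: eq_diff_eq add.commute)
  also have "\<dots> = center A - center A"
    unfolding average_diff by (simp add: average_const A center_def)
  finally show ?thesis by simp
qed

lemma affine_proj_fixed:
  assumes "finite_subgroup A" "center A + proj A w = w" "g \<in> A"
  shows "b g + \<pi> g w = w"
proof -
  have "b g + \<pi> g (center A + proj A w) = (b g + \<pi> g (center A)) + \<pi> g (proj A w)"
    using linear_add[OF linear_rep[OF finite_subgroupD(3)[OF assms(1,3)]]] by simp
  then show ?thesis using assms by (simp add: center_fixed rep_proj)
qed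

section \<open>Conjugates of finite subgroups\<close>

definition conj_set :: "'g \<Rightarrow> 'g set \<Rightarrow> 'g set" where
  "conj_set g A = (\<lambda>a. g \<otimes> a \<otimes> inv g) ` A"

lemma bij_betw_conj:
  assumes "A \<subseteq> carrier G" "g \<in> carrier G"
  shows "bij_betw (\<lambda>a. g \<otimes> a \<otimes> inv g) A (conj_set g A)"
  unfolding conj_set_def using assms by (intro inj_on_imp_bij_betw) (auto simp: inj_on_def subset_iff)

lemma conj_set_mult:
  assumes "A \<subseteq> carrier G" "g \<in> carrier G" "h \<in> carrier G"
  shows "conj_set g (conj_set h A) = conj_set (g \<otimes> h) A"
  unfolding conj_set_def image_image
  by (intro image_cong refl) (use assms in \<open>auto simp: subset_iff inv_mult_group m_assoc\<close>)

lemma finite_subgroup_conj: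
  assumes "finite_subgroup A" "g \<in> carrier G"
  shows "finite_subgroup (conj_set g A)"
  unfolding finite_subgroup_def
proof
  note A = finite_subgroupD[OF assms(1)]
  show "finite (conj_set g A)" using A(1) by (simp add: conj_set_def)
  show "subgroup (conj_set g A) G"
  proof (rule subgroupI)
    show "conj_set g A \<subseteq> carrier G" "conj_set g A \<noteq> {}"
      using A assms(2) by (auto simp: conj_set_def)
    fix x assume "x \<in> conj_set g A"
    then obtain a where a: "a \<in> A" "x = g \<otimes> a \<otimes> inv g" by (auto simp: conj_set_def)
    then have "inv x = g \<otimes> inv a \<otimes> inv g"
      using A(3) assms(2) by (simp add: inv_mult_group m_assoc)
    then show "inv x \<in> conj_set g A" using a A(4) by (auto simp: conj_set_def)
    fix y assume "y \<in> conj_set g A"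
    then obtain a' where a': "a' \<in> A" "y = g \<otimes> a' \<otimes> inv g" by (auto simp: conj_set_def)
    have "inv g \<otimes> (g \<otimes> (a' \<otimes> inv g)) = a' \<otimes> inv g"
      using a'(1) A(3) assms(2) by (simp add: m_assoc[symmetric])
    then have "x \<otimes> y = g \<otimes> (a \<otimes> a') \<otimes> inv g"
      using a a' A(3) assms(2) by (simp add: m_assoc)
    then show "x \<otimes> y \<in> conj_set g A" using a a' A(5) by (auto simp: conj_set_def)
  qed
qed

lemma proj_conj:
  assumes "finite_subgroup A" "g \<in> carrier G"
  shows "proj (conj_set g A) (\<pi> g x) = \<pi> g (proj A x)"
proof -
  note A = finite_subgroupD[OF assms(1)]
  have "proj (conj_set g A) (\<pi> g x) = average A (\<lambda>a. \<pi> (g \<otimes> a \<otimes> inv g) (\<pi> g x))"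
    unfolding proj_def by (rule average_reindex[OF bij_betw_conj]) (use A assms in auto)
  also have "\<dots> = average A (\<lambda>a. \<pi> g (\<pi> a x))"
    by (intro average_cong) (simp add: rep_mult rep_inv A assms)
  also have "\<dots> = \<pi> g (proj A x)"
    unfolding proj_def by (rule average_linear[OF linear_rep[OF assms(2)], symmetric])
  finally show ?thesis .
qed

text \<open>The affine action of \<open>g\<close> carries the affine projection of \<open>A\<close>
  to that of its conjugate. This is the equivariance evaluated at \<open>0\<close>;
  \<open>proj_conj\<close> is its linear part.\<close>

lemma center_conj:
  assumes "finite_subgroup A" "g \<in> carrier G"
  shows "center (conj_set g A) + proj (conj_set g A) (b g) = b g + \<pi> g (center A)"
proof -
  note A = finite_subgroupD[OF assms(1)]
  \<comment> \<open>Both sides expand \<open>b (g \<otimes> a)\<close>, the left one through the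
    factorization \<open>(g \<otimes> a \<otimes> inv g) \<otimes> g\<close>.\<close>
  have *: "b (g \<otimes> a \<otimes> inv g) + \<pi> (g \<otimes> a \<otimes> inv g) (b g) = b g + \<pi> g (b a)" if "a \<in> A" for a
    using cocycle_mult[of "g \<otimes> a \<otimes> inv g" g] cocycle_mult[of g a] that A(3) assms(2)
    by (simp add: m_assoc)
  have bij: "bij_betw (\<lambda>a. g \<otimes> a \<otimes> inv g) A (conj_set g A)"
    using A assms by (intro bij_betw_conj) auto
  from * have "average A (\<lambda>a. b (g \<otimes> a \<otimes> inv g) + \<pi> (g \<otimes> a \<otimes> inv g) (b g))
      = average A (\<lambda>a. b g + \<pi> g (b a))"
    by (rule average_cong)
  moreover have "center (conj_set g A) = average A (\<lambda>a. b (g \<otimes> a \<otimes> inv g))"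
    "proj (conj_set g A) (b g) = average A (\<lambda>a. \<pi> (g \<otimes> a \<otimes> inv g) (b g))"
    unfolding proj_def center_def
    by (rule average_reindex[OF bij])+
  ultimately show ?thesis
    by (simp add: average_add average_const A center_def average_linear[OF linear_rep[OF assms(2)]])
qed

text \<open>When \<open>A'\<close> normalizes \<open>A\<close>, each \<open>\<pi> g\<close> with
  \<open>g\<close> in \<open>A'\<close> commutes with \<open>proj A\<close> by
  \<open>proj_conj\<close>; it remains to average over \<open>A'\<close>.\<close>

lemma proj_commute:
  assumes "finite_subgroup A" "finite_subgroup A'" "\<And>g. g \<in> A' \<Longrightarrow> conj_set g A = A"
  shows "proj A (proj A' x) = proj A' (proj A x)"
proof -
  note A' = finite_subgroupD[OF assms(2)]
  have "proj A (proj A' x) = average A' (\<lambda>g. proj A (\<pi> g x))"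
    unfolding proj_def[of A'] by (rule average_linear[OF linear_proj[OF assms(1)]])
  also have "\<dots> = average A' (\<lambda>g. \<pi> g (proj A x))"
    using proj_conj[OF assms(1) A'(3)] assms(3) by (intro average_cong) metis
  finally show ?thesis by (simp add: proj_def[of A'])
qed

text \<open>Obtained by averaging \<open>center_conj\<close> over \<open>A'\<close>. With
  \<open>proj_commute\<close>, it says that the two affine projections commute.\<close>

lemma center_commute:
  assumes "finite_subgroup A" "finite_subgroup A'" "\<And>g. g \<in> A' \<Longrightarrow> conj_set g A = A"
  shows "center A + proj A (center A') = center A' + proj A' (center A)"
proof -
  note A' = finite_subgroupD[OF assms(2)]
  have "average A' (\<lambda>g. center A + proj A (b g)) = average A' (\<lambda>g. b g + \<pi> g (center A))"
    using center_conj[OF assms(1) A'(3)] assms(3) by (intro average_cong) metis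
  then show ?thesis
    by (simp add: average_add average_const A' center_def[of A'] proj_def[of A']
      average_linear[OF linear_proj[OF assms(1)]])
qed

lemma affine_projection_system_conj:
  assumes "finite_subgroup A" "t \<in> carrier G"
    and norm: "\<And>i j g. g \<in> conj_set (t [^] (i::int)) A \<Longrightarrow>
      conj_set g (conj_set (t [^] (j::int)) A) = conj_set (t [^] j) A"
  shows "affine_projection_system (\<lambda>i. \<pi> (t [^] i)) (\<lambda>i. proj (conj_set (t [^] i) A))
    (\<lambda>i. b (t [^] i)) (\<lambda>i. center (conj_set (t [^] i) A))"
proof -
  note A = finite_subgroupD[OF assms(1)]
  have tc: "t [^] (i::int) \<in> carrier G" for i using assms(2) by simp
  have fs: "finite_subgroup (conj_set (t [^] (i::int)) A)" for i
    by (intro finite_subgroup_conj assms tc)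
  have conj_add: "conj_set (t [^] (i + j :: int)) A = conj_set (t [^] i) (conj_set (t [^] j) A)" for i j
    using A(3) by (subst conj_set_mult) (auto simp: int_pow_mult assms(2))
  show ?thesis
  proof (rule affine_projection_system.intro)
    fix i j :: int and x :: 'h
    show "linear (\<pi> (t [^] i))" by (intro linear_rep tc)
    show "norm (\<pi> (t [^] i) x) = norm x" by (intro norm_rep tc)
    show "\<pi> (t [^] (i + j)) x = \<pi> (t [^] i) (\<pi> (t [^] j) x)"
      by (simp add: int_pow_mult assms(2) rep_mult)
    show "b (t [^] (i + j)) = b (t [^] i) + \<pi> (t [^] i) (b (t [^] j))"
      by (simp add: int_pow_mult assms(2) cocycle_mult)
    show "ortho_proj (proj (conj_set (t [^] i) A))" by (intro ortho_proj_proj fs)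
    show "proj (conj_set (t [^] i) A) (proj (conj_set (t [^] j) A) x)
        = proj (conj_set (t [^] j) A) (proj (conj_set (t [^] i) A) x)"
      by (intro proj_commute fs norm)
    show "proj (conj_set (t [^] (i + j)) A) (\<pi> (t [^] i) x)
        = \<pi> (t [^] i) (proj (conj_set (t [^] j) A) x)"
      unfolding conj_add by (intro proj_conj fs tc)
    show "proj (conj_set (t [^] i) A) (center (conj_set (t [^] i) A)) = 0"
      by (intro proj_center fs)
    show "center (conj_set (t [^] i) A) + proj (conj_set (t [^] i) A) (center (conj_set (t [^] j) A))
        = center (conj_set (t [^] j) A) + proj (conj_set (t [^] j) A) (center (conj_set (t [^] i) A))"
      by (intro center_commute fs norm)
    show "center (conj_set (t [^] (i + j)) A) + proj (conj_set (t [^] (i + j)) A) (b (t [^] i))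
        = b (t [^] i) + \<pi> (t [^] i) (center (conj_set (t [^] j) A))"
      unfolding conj_add by (intro center_conj fs tc)
  qed
qed

text \<open>\<open>A\<close> and \<open>t\<close> generate \<open>G\<close>, so vectors fixed by
  both vanish and \<open>almost_fixed_point\<close> applies. The norm in the conclusion is the
  displacement of \<open>w\<close> under the affine action of \<open>g\<close>; as \<open>A\<close>
  fixes \<open>w\<close>, it reduces to that under a power of \<open>t\<close>.\<close>

lemma almost_fixed_point_of_extension:
  assumes \<phi>: "\<phi> \<in> hom G integer_group" and t: "t \<in> carrier G" "\<phi> t = 1"
    and A: "finite_subgroup A" "A \<subseteq> kernel G integer_group \<phi>"
    and normal: "\<And>l a. l \<in> kernel G integer_group \<phi> \<Longrightarrow> a \<in> A \<Longrightarrow> l \<otimes> a \<otimes> inv l \<in> A"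
    and X: "X \<subseteq> carrier G" "generate G X = carrier G"
    and F: "finite F" "F \<subseteq> carrier G"
    and XF: "\<And>x. x \<in> X \<union> F \<Longrightarrow> x \<otimes> t [^] (- \<phi> x) \<in> A"
    and no_inv: "\<not> has_nonzero_invariant_vector G \<pi>" and "r > 0"
  shows "\<exists>w. \<forall>g\<in>F. norm (b g - (w - \<pi> g w)) < r"
proof -
  interpret \<phi>: group_hom G integer_group \<phi>
    using \<phi> by (simp add: group_hom_def group_hom_axioms_def group_axioms)
  let ?L = "kernel G integer_group \<phi>"
  have L: "l \<in> ?L \<longleftrightarrow> l \<in> carrier G \<and> \<phi> l = 0" for l by (simp add: kernel_def)
  note A' = finite_subgroupD[OF A(1)]
  have tc: "t [^] (i::int) \<in> carrier G" for i using t by simp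
  have conj_L: "g \<otimes> l \<otimes> inv g \<in> ?L" if "g \<in> carrier G" "l \<in> ?L" for g l
    using that \<phi>.hom_inv[of g] by (simp add: L)
  have A_sub: "A \<subseteq> carrier G" using A'(3) by blast
  have conj_A: "conj_set l A = A" if "l \<in> ?L" for l
  proof (rule card_subset_eq)
    show "conj_set l A \<subseteq> A" using normal[OF that] by (auto simp: conj_set_def)
    show "card (conj_set l A) = card A"
      using bij_betw_same_card[OF bij_betw_conj[of A l]] A_sub that by (simp add: L)
  qed (rule A')
  have norm: "conj_set g (conj_set (t [^] j) A) = conj_set (t [^] j) A"
    if "g \<in> conj_set (t [^] i) A" for i j :: int and g
  proof -
    have g: "g \<in> ?L" using that A(2) conj_L tc by (auto simp: conj_set_def)
    define h where "h = t [^] (- j) \<otimes> g \<otimes> t [^] j"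
    have h: "h \<in> ?L"
      using conj_L[OF tc[of "- j"] g] t by (simp add: h_def int_pow_neg)
    have "g \<otimes> t [^] j = t [^] j \<otimes> h"
      using g t by (simp add: h_def L int_pow_neg m_assoc[symmetric])
    then have "conj_set g (conj_set (t [^] j) A) = conj_set (t [^] j) (conj_set h A)"
      using A' tc g h by (simp add: conj_set_mult subset_iff L)
    then show ?thesis using h by (simp add: conj_A)
  qed
  interpret sys: affine_projection_system "\<lambda>i. \<pi> (t [^] i)" "\<lambda>i. proj (conj_set (t [^] i) A)"
    "\<lambda>i. b (t [^] i)" "\<lambda>i. center (conj_set (t [^] i) A)"
    by (rule affine_projection_system_conj[OF A(1) t(1) norm])
  have conj_0: "conj_set \<one> A = A"
    using A'(3) by (simp add: conj_set_def image_def)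
  have decomp: "g = (g \<otimes> t [^] (- \<phi> g)) \<otimes> t [^] \<phi> g" if "g \<in> carrier G" for g
    using that t by (simp add: m_assoc int_pow_mult[symmetric])
  have no_fixed: "z = 0" if z: "proj (conj_set (t [^] (0::int)) A) z = z" "\<pi> (t [^] (1::int)) z = z" for z
  proof -
    have A_fixed: "\<pi> a z = z" if "a \<in> A" for a
      using rep_proj[OF A(1) that, of z] z(1) by (simp add: conj_0)
    \<comment> \<open>With zero cocycle and zero centers, \<open>T\<close> becomes the linear
      action; a zero displacement under \<open>t\<close> then gives zero displacement under all its
      powers, negative ones included.\<close>
    interpret fixed: affine_projection_system "\<lambda>i. \<pi> (t [^] i)" "\<lambda>i. proj (conj_set (t [^] i) A)"
      "\<lambda>i. 0" "\<lambda>i. 0"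
      by unfold_locales
        (auto simp: sys.U_simps sys.norm_U sys.U_add sys.proj_P sys.P_comm sys.P_shift sys.P_simps)
    have t_fixed: "\<pi> (t [^] i) z = z" for i :: int
      using fixed.norm_T_minus_le[of i z] z(2) by (simp add: fixed.T_def)
    have X_fixed: "\<pi> x z = z" if "x \<in> X" for x
      using that X(1) decomp[of x] XF[of x] A_fixed t_fixed A'(3) tc
      by (metis UnI1 rep_mult subsetD)
    have "\<pi> g z = z" if "g \<in> generate G X" for g
      using that
    proof (induction rule: generate.induct)
      case one
      show ?case by (rule rep_one)
    next
      case (incl h)
      then show ?case by (rule X_fixed)
    next
      case (inv h)
      then show ?case using rep_inv(1)[of h z] X_fixed[of h] X(1) by auto
    next
      case (eng h1 h2)
      then show ?case using generate_in_carrier[OF X(1)] by (simp add: rep_mult)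
    qed
    then show "z = 0" using no_inv X(2) by (auto simp: has_nonzero_invariant_vector_def)
  qed
  \<comment> \<open>Bounds every \<open>\<bar>\<phi> g\<bar>\<close> on \<open>F\<close>; the
    summand \<open>1\<close> keeps it positive even if \<open>\<phi>\<close> vanishes there.\<close>
  define m where "m = 1 + (\<Sum>g\<in>F. \<bar>real_of_int (\<phi> g)\<bar>)"
  have m: "m > 0" unfolding m_def by (intro add_pos_nonneg sum_nonneg) auto
  obtain w where w: "center (conj_set (t [^] (0::int)) A) + proj (conj_set (t [^] (0::int)) A) w = w"
    "norm (sys.T 1 w - w) < r / m"
    using sys.almost_fixed_point[of "r / m"] no_fixed m \<open>r > 0\<close> by auto
  have "norm (b g - (w - \<pi> g w)) < r" if g: "g \<in> F" for g
  proof -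
    let ?l = "g \<otimes> t [^] (- \<phi> g)"
    have gc: "g \<in> carrier G" and lA: "?l \<in> A" using g F(2) XF by auto
    note lc = A'(3)[OF lA]
    have l_fixed: "b ?l + \<pi> ?l w = w"
      using affine_proj_fixed[OF A(1) _ lA] w(1) by (simp add: conj_0)
    \<comment> \<open>\<open>g\<close> is \<open>?l\<close> times \<open>t [^] \<phi> g\<close>, and
      \<open>?l\<close> acts by an affine isometry that fixes \<open>w\<close>.\<close>
    have "b g - (w - \<pi> g w) = (b ?l + \<pi> ?l (sys.T (\<phi> g) w)) - (b ?l + \<pi> ?l w)"
      unfolding l_fixed sys.T_def linear_add[OF linear_rep[OF lc]]
      using cocycle_mult[OF lc tc] rep_mult[OF lc tc] decomp[OF gc]
      by (metis (no_types, lifting) add.assoc diff_diff_eq2)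
    then have "norm (b g - (w - \<pi> g w)) = norm (sys.T (\<phi> g) w - w)"
      using norm_rep[OF lc] linear_diff[OF linear_rep[OF lc]] by (metis add_diff_cancel_left)
    also have "\<dots> \<le> \<bar>real_of_int (\<phi> g)\<bar> * norm (sys.T 1 w - w)" by (rule sys.norm_T_minus_le)
    also have "\<dots> \<le> m * norm (sys.T 1 w - w)"
    proof (rule mult_right_mono)
      have "\<bar>real_of_int (\<phi> g)\<bar> \<le> (\<Sum>g\<in>F. \<bar>real_of_int (\<phi> g)\<bar>)"
        using g F(1) by (intro member_le_sum) auto
      then show "\<bar>real_of_int (\<phi> g)\<bar> \<le> m" by (simp add: m_def)
    qed simp
    also have "\<dots> < r" using w(2) m by (simp add: less_divide_eq mult.commute)
    finally show ?thesis .
  qed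
  then show ?thesis by blast
qed

end

section \<open>Finite-dimensional subrepresentations and the conclusion\<close>

lemma invariant_vector_imp_fd_subrep:
  assumes "unitary_rep G \<pi>" "has_nonzero_invariant_vector G \<pi>"
  shows "has_nonzero_fd_subrep G \<pi>"
proof -
  obtain v where v: "v \<noteq> 0" "\<And>g. g \<in> carrier G \<Longrightarrow> \<pi> g v = v"
    using assms(2) by (auto simp: has_nonzero_invariant_vector_def)
  have "\<pi> g (scaleC c v) = scaleC c v" if "g \<in> carrier G" for g c
    using assms(1) that v(2) by (simp add: unitary_rep_def unitary_operator_def)
  moreover have "v \<in> complex_span {v}"
    by (auto simp: complex_span_def scaleC_one intro!: exI[of _ "\<lambda>_. 1"])
  ultimately show ?thesis
    unfolding has_nonzero_fd_subrep_def using v(1)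
    by (intro exI[of _ "{v}"] conjI bexI[of _ v]) (auto simp: complex_span_def)
qed

text \<open>Normality in the restricted group is expressed with the operations of \<open>G\<close>,
  in which the averages are formed.\<close>

lemma locally_normally_finite_kernel_obtain:
  assumes "group_hom G H \<phi>" "locally_normally_finite (G\<lparr>carrier := kernel G H \<phi>\<rparr>)"
    and "finite S" "S \<subseteq> kernel G H \<phi>"
  obtains A where "S \<subseteq> A" "finite A" "subgroup A G" "A \<subseteq> kernel G H \<phi>"
    "\<And>l a. l \<in> kernel G H \<phi> \<Longrightarrow> a \<in> A \<Longrightarrow> l \<otimes>\<^bsub>G\<^esub> a \<otimes>\<^bsub>G\<^esub> inv\<^bsub>G\<^esub> l \<in> A"
proof -
  interpret group_hom G H \<phi> by (rule assms(1))
  let ?L = "G\<lparr>carrier := kernel G H \<phi>\<rparr>"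
  obtain A where A: "S \<subseteq> A" "finite A" "A \<lhd> ?L"
    using assms(2-4) by (auto simp: locally_normally_finite_def)
  interpret A: normal A ?L by (rule A(3))
  show thesis
  proof (rule that[OF A(1,2)])
    show "subgroup A G"
      by (rule G.incl_subgroup[OF subgroup_kernel A.subgroup_axioms])
    show "A \<subseteq> kernel G H \<phi>" using A.subset by simp
    show "l \<otimes>\<^bsub>G\<^esub> a \<otimes>\<^bsub>G\<^esub> inv\<^bsub>G\<^esub> l \<in> A" if "l \<in> kernel G H \<phi>" "a \<in> A" for l a
      using A.inv_op_closed2[of l a] that G.m_inv_consistent[OF subgroup_kernel that(1)] by simp
  qed
qed

theorem theorem1p1:
  fixes G :: "('g, 'b) monoid_scheme"
  assumes "finitely_generated_group G"
    and "extension_of_Z_by_LNF G"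
  shows "property_HT G TYPE('h::chilbert_space) \<and> property_HFD G TYPE('h::chilbert_space)"
proof -
  obtain X where X: "finite X" "X \<subseteq> carrier G" "generate G X = carrier G"
    using assms(1) by (auto simp: finitely_generated_group_def)
  obtain \<phi> where \<phi>: "group G" "\<phi> \<in> hom G integer_group" "\<phi> ` carrier G = carrier integer_group"
    "locally_normally_finite (G\<lparr>carrier := kernel G integer_group \<phi>\<rparr>)"
    using assms(2) by (auto simp: extension_of_Z_by_LNF_def)
  interpret group_hom G integer_group \<phi>
    using \<phi>(1,2) by (simp add: group_hom_def group_hom_axioms_def)
  have "1 \<in> \<phi> ` carrier G" using \<phi>(3) by simp
  then obtain t where t: "t \<in> carrier G" "\<phi> t = 1" by fastforce
  have "has_nonzero_invariant_vector G \<pi>"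
    if \<pi>: "unitary_rep G \<pi>" "reduced_H1_nonzero G \<pi>" for \<pi> :: "'g \<Rightarrow> 'h \<Rightarrow> 'h"
  proof (rule ccontr)
    assume no_inv: "\<not> has_nonzero_invariant_vector G \<pi>"
    obtain b where b: "cocycle G \<pi> b" "\<not> in_closure_coboundaries G \<pi> b"
      using \<pi>(2) by (auto simp: reduced_H1_nonzero_def)
    interpret unitary_cocycle G \<pi> b by unfold_locales (rule \<pi>(1) b(1))+
    have "\<exists>w. \<forall>g\<in>F. norm (b g - (w - \<pi> g w)) < r"
      if F: "finite F" "F \<subseteq> carrier G" and "r > 0" for F r
    proof -
      \<comment> \<open>Dividing by the power of \<open>t\<close> with the same image puts each
        generator and each element of \<open>F\<close> into the kernel; as these are finitely many,
        one finite normal subgroup of the kernel contains them all.\<close>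
      let ?S = "(\<lambda>x. x \<otimes>\<^bsub>G\<^esub> t [^]\<^bsub>G\<^esub> (- \<phi> x)) ` (X \<union> F)"
      have "?S \<subseteq> kernel G integer_group \<phi>"
        using X F t by (auto simp: kernel_def hom_int_pow)
      then obtain A where A: "?S \<subseteq> A" "finite A" "subgroup A G" "A \<subseteq> kernel G integer_group \<phi>"
        "\<And>l a. l \<in> kernel G integer_group \<phi> \<Longrightarrow> a \<in> A \<Longrightarrow> l \<otimes>\<^bsub>G\<^esub> a \<otimes>\<^bsub>G\<^esub> inv\<^bsub>G\<^esub> l \<in> A"
        using locally_normally_finite_kernel_obtain[OF group_hom_axioms \<phi>(4), of ?S] X(1) F(1) by blast
      show ?thesis
        by (rule almost_fixed_point_of_extension[OF \<phi>(2) t _ A(4,5) X(2,3) F _ no_inv \<open>r > 0\<close>])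
           (use A in \<open>auto simp: finite_subgroup_def\<close>)
    qed
    then show False using b(2) by (auto simp: in_closure_coboundaries_def)
  qed
  then show ?thesis
    using assms(1) invariant_vector_imp_fd_subrep
    unfolding property_HT_def property_HFD_def by blast
qed

end
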